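(* For a $c$-chain $P$ with $n$ vertices in the Euclidean plane $\mathbb{R}^2$ we have $\delta_P=O\left(c^2\sqrt{n-1}\right)$. That is, there is an absolute constant $C>0$ such that for every real number $c\ge 1$, every integer $n\ge 2$, and every $c$-chain $P=(p_1,\dots,p_n)$ in $\mathbb{R}^2$ with $n$ vertices and $p_1\ne p_n$, $$\delta_P\le C\,c^2\sqrt{n-1}.$$
   Context: A polygonal chain $P=(p_1,\dots,p_n)$ in $\mathbb{R}^2$ is specified by a sequence of $n$ points $p_1,\dots,p_n$, called its vertices; it consists of the $n-1$ line segments between consecutive vertices (which are allowed to cross). $|pq|$ denotes the Euclidean distance between $p$ and $q$. For a real number $c\ge 1$, $P$ is called a $c$-chain if $|p_ip_j|+|p_jp_k|\le c\,|p_ip_k|$ for all $1\le i<j<k\le n$. The stretch factor of $P$ is $$\delta_P=\frac{\sum_{i=1}^{n-1}|p_ip_{i+1}|}{|p_1p_n|}.$$ *)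

theory Defs
  imports "HOL-Analysis.Analysis"
begin

text \<open>A polygonal chain is represented by the list of its vertices, indexed from 0:
  the vertex \<open>p\<^sub>i\<close> is \<open>P ! (i - 1)\<close>.\<close>

type_synonym chain = "(real^2) list"

definition c_chain :: "real \<Rightarrow> chain \<Rightarrow> bool" where
  "c_chain c P \<longleftrightarrow>
     (\<forall>i j k. i < j \<and> j < k \<and> k < length P \<longrightarrow>
        dist (P ! i) (P ! j) + dist (P ! j) (P ! k) \<le> c * dist (P ! i) (P ! k))"

text \<open>Meaningful only if \<open>hd P \<noteq> last P\<close>; otherwise the value is 0, by division by zero.\<close>

definition stretch_factor :: "chain \<Rightarrow> real" where
  "stretch_factor P =
     (\<Sum>i<length P - 1. dist (P ! i) (P ! Suc i)) / dist (hd P) (last P)"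

end

theory Submission
  imports Defs
begin

text \<open>Put \<open>D = |p\<^sub>1 p\<^sub>n|\<close>. By the chain condition all vertices lie within \<open>c D\<close> of \<open>p\<^sub>1\<close>, and the
  initial vertices of the edges of length at least \<open>l\<close> are pairwise at distance at least \<open>l / c\<close>.
  Packing in the plane therefore allows only \<open>O((c\<^sup>2 D / l)\<^sup>2)\<close> such edges, so the \<open>k\<close>-th longest edge
  has length \<open>O(c\<^sup>2 D / sqrt k)\<close>, and summing over \<open>k < n\<close> gives the bound.\<close>

text \<open>The ball of radius \<open>R\<close> around \<open>x\<close> lies in a square of side
  \<open>2 * R\<close>, which is covered by a grid of half-open cells of side \<open>d / 2\<close>.
  Two points in one cell differ by less than \<open>d / 2\<close> in each coordinate, so by less
  than \<open>d\<close> in the l1 norm, which dominates the Euclidean one. Hence each cell holds at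
  most one point.\<close>

lemma card_separated_le:
  fixes f :: "'a \<Rightarrow> real^2"
  assumes "finite X" "d > 0" "R \<ge> 0"
    and near: "\<And>i. i \<in> X \<Longrightarrow> dist x (f i) \<le> R"
    and sep: "\<And>i j. \<lbrakk>i \<in> X; j \<in> X; i \<noteq> j\<rbrakk> \<Longrightarrow> d \<le> dist (f i) (f j)"
  shows "real (card X) \<le> (4 * R / d + 1)\<^sup>2"
proof -
  \<comment> \<open>Coordinates measured from the lower left corner of the square, with the cell
    side as unit; \<open>g\<close> then names the cell of a point.\<close>
  define u where "u i k = ((f i - x) $ k + R) / (d / 2)" for i and k :: 2
  define g where "g i = (\<lfloor>u i 1\<rfloor>, \<lfloor>u i 2\<rfloor>)" for i
  \<comment> \<open>The side \<open>2 * R\<close> is \<open>4 * R / d\<close> cell sides long, so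
    the indices on each axis run from 0 to \<open>m\<close>.\<close>
  define m where "m = \<lfloor>4 * R / d\<rfloor>"
  have m: "m \<ge> 0" "real_of_int m \<le> 4 * R / d"
    using assms by (auto simp: m_def)
  have cell: "\<lfloor>u i k\<rfloor> \<in> {0..m}" if "i \<in> X" for i k
  proof -
    have "\<bar>(f i - x) $ k\<bar> \<le> R"
      using component_le_norm_cart[of "f i - x" k] near[OF that]
      by (simp add: dist_norm norm_minus_commute)
    then have "0 \<le> u i k" "u i k \<le> (R + R) / (d / 2)"
      using \<open>d > 0\<close> unfolding u_def by (auto intro!: divide_nonneg_pos divide_right_mono)
    then show ?thesis
      by (auto simp: m_def intro!: floor_mono)
  qed
  have "inj_on g X"
  proof (rule inj_onI, rule ccontr)
    fix i j assume ij: "i \<in> X" "j \<in> X" "g i = g j" "i \<noteq> j"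
    have close: "\<bar>(f i - f j) $ k\<bar> < d / 2" if "\<lfloor>u i k\<rfloor> = \<lfloor>u j k\<rfloor>" for k
    proof -
      have "\<bar>u i k - u j k\<bar> < 1"
        using that by linarith
      moreover have "u i k - u j k = (f i - f j) $ k / (d / 2)"
        by (simp add: u_def add_divide_distrib diff_divide_distrib algebra_simps)
      ultimately have "\<bar>(f i - f j) $ k\<bar> / (d / 2) < 1"
        using \<open>d > 0\<close> by (metis abs_divide abs_of_pos half_gt_zero)
      then show ?thesis
        using \<open>d > 0\<close> by (simp add: pos_divide_less_eq)
    qed
    have "dist (f i) (f j) \<le> \<bar>(f i - f j) $ 1\<bar> + \<bar>(f i - f j) $ 2\<bar>"
      using norm_le_l1_cart[of "f i - f j"] by (simp add: dist_norm sum_2)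
    also have "\<dots> < d"
      using close[of 1] close[of 2] ij by (simp add: g_def)
    finally show False
      using sep[of i j] ij by simp
  qed
  moreover have "g ` X \<subseteq> {0..m} \<times> {0..m}"
    using cell by (auto simp: g_def)
  ultimately have "card X \<le> card ({0..m} \<times> {0..m})"
    by (intro card_inj_on_le) auto
  also have "real \<dots> = (real_of_int m + 1)\<^sup>2"
    using m by (simp add: card_cartesian_product power2_eq_square)
  also have "\<dots> \<le> (4 * R / d + 1)\<^sup>2"
    using m by (intro power_mono) auto
  finally show ?thesis by simp
qed

text \<open>The second assumption bounds the \<open>k\<close>-th largest value by
  \<open>K / sqrt k\<close>, and the sum of \<open>1 / sqrt k\<close> for \<open>k\<close> up to
  \<open>n\<close> is at most \<open>2 * sqrt n\<close>. Induction by removing a minimal element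
  avoids sorting: its count is all of \<open>A\<close>.\<close>

lemma sum_le_sqrt_card:
  fixes f :: "'a \<Rightarrow> real"
  assumes "finite A"
    and "\<And>a. a \<in> A \<Longrightarrow> f a * sqrt (card {b \<in> A. f a \<le> f b}) \<le> K"
    and "K \<ge> 0" "\<And>a. a \<in> A \<Longrightarrow> f a \<ge> 0"
  shows "sum f A \<le> 2 * K * sqrt (card A)"
  using assms
proof (induction "card A" arbitrary: A)
  case 0
  then show ?case by simp
next
  case (Suc m)
  then have "A \<noteq> {}" by auto
  then obtain a where a: "a \<in> A" "\<And>b. b \<in> A \<Longrightarrow> f a \<le> f b"
    using ex_min_if_finite[of "f ` A"] Suc.prems(1)
    by (metis arg_min_if_finite(1) arg_min_least)
  have "{b \<in> A. f a \<le> f b} = A"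
    using a by auto
  then have fa: "f a * sqrt (Suc m) \<le> K"
    using Suc.prems(2)[OF a(1)] Suc.hyps(2) by simp
  have cm: "card (A - {a}) = m"
    using Suc.hyps(2) Suc.prems(1) a(1) by simp
  have "sum f (A - {a}) \<le> 2 * K * sqrt (card (A - {a}))"
  proof (rule Suc.hyps(1))
    fix b assume b: "b \<in> A - {a}"
    \<comment> \<open>The assumption passes to \<open>A - {a}\<close>, since removing an element can
      only lower the counts.\<close>
    have "f b * sqrt (card {x \<in> A - {a}. f b \<le> f x}) \<le> f b * sqrt (card {x \<in> A. f b \<le> f x})"
      using Suc.prems(1,4) b
      by (intro mult_left_mono real_sqrt_le_mono of_nat_mono card_mono) auto
    also have "\<dots> \<le> K"
      using Suc.prems(2) b by auto
    finally show "f b * sqrt (card {x \<in> A - {a}. f b \<le> f x}) \<le> K" .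
  qed (use Suc.prems cm in auto)
  then have IH: "sum f (A - {a}) \<le> 2 * K * sqrt m"
    using cm by simp
  define r s where "r = sqrt (Suc m)" and "s = sqrt m"
  have rs: "r > 0" "r * r = m + 1" "s * s = m"
    by (simp_all add: r_def s_def)
  \<comment> \<open>As \<open>r * r - s * s = 1\<close>, the right side equals
    \<open>1 + (r - s) * (r - s)\<close>. Divided by \<open>r\<close>, this is the telescoping bound
    on \<open>1 / sqrt (m + 1)\<close>.\<close>
  have "1 \<le> 2 * (r - s) * r"
    using rs zero_le_square[of "r - s"] by (simp add: algebra_simps)
  then have "K * 1 \<le> K * (2 * (r - s) * r)"
    using \<open>K \<ge> 0\<close> by (intro mult_left_mono)
  then have "f a * r \<le> (2 * K * (r - s)) * r"
    using fa by (simp add: r_def algebra_simps)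
  then have "f a \<le> 2 * K * (r - s)"
    using rs(1) by simp
  then have "f a + sum f (A - {a}) \<le> 2 * K * r"
    using IH by (simp add: s_def algebra_simps)
  then show ?case
    using sum.remove[OF Suc.prems(1) a(1), of f] Suc.hyps(2) by (simp add: r_def)
qed

text \<open>The case \<open>j = k\<close>, on which \<open>c_chain\<close> is silent, follows from
  \<open>c \<ge> 1\<close>. It is included for two long edges that share a vertex and for the last
  vertex of the chain.\<close>

lemma c_chain_dist_left:
  assumes "c_chain c P" "c \<ge> 1" "i < j" "j \<le> k" "k < length P"
  shows "dist (P ! i) (P ! j) \<le> c * dist (P ! i) (P ! k)"
proof (cases "j = k")
  case True
  then show ?thesis
    using mult_right_mono[of 1 c "dist (P ! i) (P ! k)"] assms by simp
next
  case False
  then have "dist (P ! i) (P ! j) + dist (P ! j) (P ! k) \<le> c * dist (P ! i) (P ! k)"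
    using assms by (auto simp: c_chain_def)
  then show ?thesis
    using zero_le_dist[of "P ! j" "P ! k"] by linarith
qed

text \<open>The edge at \<open>a\<close> witnesses that edges of length at least \<open>l\<close>
  exist. This forces \<open>l \<le> 2 * c * D\<close>, so the additive 1 of the packing bound is
  absorbed into the main term.\<close>

lemma c_chain_card_long_edges:
  fixes P :: chain
  defines "D \<equiv> dist (P ! 0) (P ! (length P - 1))"
  assumes "c_chain c P" "c \<ge> 1" "l > 0" "a < length P - 1" "l \<le> dist (P ! a) (P ! Suc a)"
  shows "l * sqrt (card {i \<in> {..<length P - 1}. l \<le> dist (P ! i) (P ! Suc i)}) \<le> 6 * c\<^sup>2 * D"
    (is "l * sqrt (card ?X) \<le> _")
proof -
  have D: "D \<ge> 0" by (simp add: D_def)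
  have near: "dist (P ! 0) (P ! i) \<le> c * D" if "i < length P" for i
    using c_chain_dist_left[OF assms(2,3), of 0 i "length P - 1"] that D \<open>c \<ge> 1\<close>
    by (cases "i = 0") (auto simp: D_def)
  have sep_lt: "l / c \<le> dist (P ! i) (P ! j)" if "i \<in> ?X" "j \<in> ?X" "i < j" for i j
  proof -
    have "l \<le> c * dist (P ! i) (P ! j)"
      \<comment> \<open>Since \<open>Suc i \<le> j\<close>, the whole edge at \<open>i\<close>
        precedes or ends at vertex \<open>j\<close>.\<close>
      using c_chain_dist_left[OF assms(2,3), of i "Suc i" j] that by fastforce
    then show ?thesis
      using \<open>c \<ge> 1\<close> by (simp add: field_simps)
  qed
  have sep: "l / c \<le> dist (P ! i) (P ! j)" if "i \<in> ?X" "j \<in> ?X" "i \<noteq> j" for i j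
    using sep_lt[of i j] sep_lt[of j i] that by (cases i j rule: linorder_cases) (auto simp: dist_commute)
  have "real (card ?X) \<le> (4 * (c * D) / (l / c) + 1)\<^sup>2"
    by (rule card_separated_le[where x = "P ! 0" and f = "(!) P"])
      (use assms D near sep in auto)
  then have "sqrt (card ?X) \<le> 4 * (c * D) / (l / c) + 1"
    using assms D by (intro real_le_lsqrt) auto
  then have "l * sqrt (card ?X) \<le> l * (4 * (c * D) / (l / c) + 1)"
    using \<open>l > 0\<close> by simp
  also have "\<dots> = 4 * c\<^sup>2 * D + l"
    using \<open>l > 0\<close> \<open>c \<ge> 1\<close> by (simp add: field_simps power2_eq_square)
  \<comment> \<open>Both ends of the edge at \<open>a\<close> lie within \<open>c * D\<close> of the
    first vertex. With the 4 from packing this gives the constant 6.\<close>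
  also have "l \<le> 2 * (c * D)"
    using dist_triangle3[of "P ! a" "P ! Suc a" "P ! 0"] near[of a] near[of "Suc a"] assms(5,6)
    by linarith
  also have "c * D \<le> c\<^sup>2 * D"
    using \<open>c \<ge> 1\<close> D by (intro mult_right_mono) (auto simp: power2_eq_square)
  finally show ?thesis by (simp add: mult.commute)
qed

theorem theorem3:
  shows "\<exists>C::real. C > 0 \<and>
    (\<forall>(c::real) (n::nat) (P::chain).
       c \<ge> 1 \<longrightarrow> n \<ge> 2 \<longrightarrow> length P = n \<longrightarrow> c_chain c P \<longrightarrow> hd P \<noteq> last P \<longrightarrow>
       stretch_factor P \<le> C * c\<^sup>2 * sqrt (real n - 1))"
\<comment> \<open>12 is the factor 2 of \<open>sum_le_sqrt_card\<close> times the 6 of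
  \<open>c_chain_card_long_edges\<close>.\<close>
proof (intro exI[of _ 12] conjI allI impI)
  fix c :: real and n :: nat and P :: chain
  assume c: "c \<ge> 1" and n: "n \<ge> 2" "length P = n" and ch: "c_chain c P"
    and ends: "hd P \<noteq> last P"
  define D where "D = dist (P ! 0) (P ! (length P - 1))"
  have "P \<noteq> []" using n by auto
  then have D: "dist (hd P) (last P) = D"
    by (simp add: D_def hd_conv_nth last_conv_nth)
  then have "D > 0" using ends by auto
  define e where "e i = dist (P ! i) (P ! Suc i)" for i
  have "sum e {..<n - 1} \<le> 2 * (6 * c\<^sup>2 * D) * sqrt (card {..<n - 1})"
  proof (rule sum_le_sqrt_card)
    fix a assume a: "a \<in> {..<n - 1}"
    show "e a * sqrt (card {b \<in> {..<n - 1}. e a \<le> e b}) \<le> 6 * c\<^sup>2 * D"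
    \<comment> \<open>The threshold \<open>l\<close> is the length of the edge at \<open>a\<close>
      itself, so that edge serves as witness. Repeated consecutive vertices give length 0 and are
      split off because the counting lemma divides by \<open>l\<close>.\<close>
    proof (cases "e a = 0")
      case False
      then show ?thesis
        using c_chain_card_long_edges[OF ch c, of "e a" a] a n by (simp add: e_def D_def)
    qed (use \<open>D > 0\<close> in simp)
  qed (use \<open>D > 0\<close> in \<open>auto simp: e_def\<close>)
  then show "stretch_factor P \<le> 12 * c\<^sup>2 * sqrt (real n - 1)"
    using \<open>D > 0\<close> n by (simp add: stretch_factor_def D e_def field_simps of_nat_diff)
qed simp

end
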